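(* Let $n$ be a nonnegative integer. There is an irreducible overlap-free binary word of length $n$ if and only if $n \in \{6, 8, 9, 10\} \cup \{m \mid m \geq 12\}$.
   Context: Words are finite strings over the binary alphabet $\{0,1\}$. A factor of a word is a contiguous subword. An overlap is a word of the form $xYxYx$ where $x$ is a letter and $Y$ is a (possibly empty) word; a word is overlap-free if none of its factors is an overlap. A letter of a word is interior if it is neither the first nor the last letter of the word. An irreducible overlap-free word is an overlap-free word of length at least $3$ such that removing any one of its interior letters yields a word containing an overlap as a factor. *)

theory Defs
  imports Main "HOL-Library.Sublist"
begin

definition overlap :: "'a list \<Rightarrow> bool" where
  "overlap u \<longleftrightarrow> (\<exists>x Y. u = [x] @ Y @ [x] @ Y @ [x])"

text \<open>A factor of a word is a contiguous subword, which is \<^const>\<open>sublist\<close>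
  (\<^const>\<open>subseq\<close> would be the scattered notion).\<close>

definition overlap_free :: "'a list \<Rightarrow> bool" where
  "overlap_free w \<longleftrightarrow> \<not> (\<exists>u. sublist u w \<and> overlap u)"

definition remove_letter :: "nat \<Rightarrow> 'a list \<Rightarrow> 'a list" where
  "remove_letter i w = take i w @ drop (Suc i) w"

text \<open>Positions are counted from 0, so the interior ones are those strictly between
  0 and \<^term>\<open>length w - 1\<close>.\<close>

definition irreducible_overlap_free :: "'a list \<Rightarrow> bool" where
  "irreducible_overlap_free w \<longleftrightarrow>
     overlap_free w \<and> length w \<ge> 3 \<and>
     (\<forall>i. 0 < i \<and> i < length w - 1 \<longrightarrow>
        (\<exists>u. sublist u (remove_letter i w) \<and> overlap u))"

end

theory Submission
  imports Defs
begin

text \<open>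
  The witnesses are factors of the Thue--Morse word. Irreducibility is a local property there:
  deleting the middle letter of any factor of length 9 creates an overlap, so only the first
  three interior letters and the last three interior letters of a factor need care. Whether they
  are critical depends on a few letters near the ends, and hence, by self-similarity of the word,
  on a short factor and its position modulo a power of 2. Ends at positions congruent to 0, 5 or 8
  modulo 16 are always good, and there are good starts in every even residue class modulo 16;
  these combine to all lengths from 34 on.
\<close>

section \<open>Deciding whether a word contains an overlap\<close>

text \<open>An overlap \<open>xYxYx\<close> is a word of length \<open>2 * p + 1\<close> with period
  \<open>p = Suc (length Y)\<close>. Searching over \<open>p\<close> makes the test
  executable.\<close>

definition starts_with_overlap :: "'a list \<Rightarrow> bool" where
  "starts_with_overlap w \<longleftrightarrow> list_ex (\<lambda>p. prefix (take (Suc p) w) (drop p w)) [1..<length w]"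

fun has_overlap :: "'a list \<Rightarrow> bool" where
  "has_overlap [] \<longleftrightarrow> False"
| "has_overlap (x # xs) \<longleftrightarrow> starts_with_overlap (x # xs) \<or> has_overlap xs"

lemma overlap_prefix_iff_starts_with_overlap:
  "(\<exists>u. prefix u w \<and> overlap u) \<longleftrightarrow> starts_with_overlap w"
proof
  assume "\<exists>u. prefix u w \<and> overlap u"
  then obtain x Y z where w: "w = x # Y @ x # Y @ x # z"
    by (auto simp: overlap_def prefix_def)
  have "prefix (take (Suc (Suc (length Y))) w) (drop (Suc (length Y)) w)"
    by (simp add: w)
  moreover have "Suc (length Y) \<in> set [1..<length w]"
    unfolding set_upt atLeastLessThan_iff by (simp add: w)
  ultimately show "starts_with_overlap w"
    unfolding starts_with_overlap_def list_ex_iff by blast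
next
  assume "starts_with_overlap w"
  then obtain p where p: "1 \<le> p" "p < length w" "prefix (take (Suc p) w) (drop p w)"
    by (auto simp: starts_with_overlap_def list_ex_iff)
  then obtain z where z: "drop p w = take (Suc p) w @ z"
    by (auto simp: prefix_def)
  obtain x v where xv: "w = x # v"
    using p by (cases w) auto
  define Y where "Y = take (p - 1) v"
  have take_p: "take p w = x # Y"
    using p xv by (cases p) (auto simp: Y_def)
  have "w = take p w @ drop p w"
    by simp
  also have "\<dots> = (x # Y) @ take (Suc p) w @ z"
    using z take_p by simp
  also have "take (Suc p) w = take p w @ [w ! p]"
    using p by (simp add: take_Suc_conv_app_nth)
  also have "w ! p = x"
    using z p xv by (metis Cons_nth_drop_Suc append_Cons list.inject take_Suc_Cons)
  finally have "w = ([x] @ Y @ [x] @ Y @ [x]) @ z"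
    using take_p by simp
  then have "prefix ([x] @ Y @ [x] @ Y @ [x]) w"
    by (metis prefixI)
  then show "\<exists>u. prefix u w \<and> overlap u"
    unfolding overlap_def by blast
qed

lemma overlap_sublist_iff_has_overlap:
  "(\<exists>u. sublist u w \<and> overlap u) \<longleftrightarrow> has_overlap w"
proof (induction w)
  case Nil
  then show ?case by (auto simp: overlap_def)
next
  case (Cons x xs)
  then show ?case
    using overlap_prefix_iff_starts_with_overlap[of "x # xs"]
    by (auto simp: sublist_Cons_right)
qed

lemma has_overlap_mono: "has_overlap v \<Longrightarrow> sublist v w \<Longrightarrow> has_overlap w"
  by (meson overlap_sublist_iff_has_overlap sublist_order.order.trans)

lemma irreducible_overlap_free_iff:
  "irreducible_overlap_free w \<longleftrightarrow>
     \<not> has_overlap w \<and> 3 \<le> length w \<and>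
     (\<forall>i \<in> {1..<length w - 1}. has_overlap (take i w @ drop (Suc i) w))"
  by (auto simp: irreducible_overlap_free_def overlap_free_def remove_letter_def
      overlap_sublist_iff_has_overlap)

section \<open>Lengths without an irreducible word\<close>

text \<open>Words grow at the front: the tail is already overlap-free, so a new overlap must be a
  prefix.\<close>

fun overlap_free_words :: "nat \<Rightarrow> bool list list" where
  "overlap_free_words 0 = [[]]"
| "overlap_free_words (Suc n) =
     filter (\<lambda>w. \<not> starts_with_overlap w)
       (concat (map (\<lambda>w. [False # w, True # w]) (overlap_free_words n)))"

lemma overlap_free_words_complete:
  "\<not> has_overlap w \<Longrightarrow> w \<in> set (overlap_free_words (length w))"
proof (induction w)
  case (Cons x xs)
  then have "xs \<in> set (overlap_free_words (length xs))"
    by simp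
  moreover have "x # xs \<in> set [False # xs, True # xs]"
    by (cases x) auto
  ultimately show ?case
    using Cons.prems by fastforce
qed simp

lemma no_irreducible_by_enumeration:
  fixes w :: "bool list"
  assumes "list_all (\<lambda>w. list_ex (\<lambda>i. \<not> has_overlap (take i w @ drop (Suc i) w)) [1..<n - 1])
             (overlap_free_words n)"
    and "length w = n"
  shows "\<not> irreducible_overlap_free w"
  using assms overlap_free_words_complete[of w]
  by (force simp: irreducible_overlap_free_iff list_all_iff list_ex_iff)

lemma no_irreducible_short:
  "\<forall>n \<in> set [3, 4, 5, 7, 11].
     list_all (\<lambda>w. list_ex (\<lambda>i. \<not> has_overlap (take i w @ drop (Suc i) w)) [1..<n - 1])
       (overlap_free_words n)"
  by code_simp

lemma irreducible_length:
  assumes "irreducible_overlap_free (w :: bool list)"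
  shows "length w \<in> {6, 8, 9, 10} \<union> {m. m \<ge> 12}"
proof (rule ccontr)
  assume "\<not> ?thesis"
  moreover have "3 \<le> length w"
    using assms by (simp add: irreducible_overlap_free_iff)
  \<comment> \<open>These are the lengths from 3 on outside the claimed set; all of them are small
    enough for enumeration.\<close>
  ultimately have "length w \<in> set [3, 4, 5, 7, 11]"
    by simp presburger
  then show False
    using no_irreducible_short no_irreducible_by_enumeration assms by blast
qed

section \<open>The Thue--Morse word\<close>

text \<open>The value is the parity of the number of ones in the binary expansion of
  \<open>n\<close>.\<close>

fun tm :: "nat \<Rightarrow> bool" where
  "tm n \<longleftrightarrow> (if n = 0 then False else tm (n div 2) \<noteq> odd n)"

declare tm.simps [simp del]

lemma tm_double [simp]: "tm (2 * n) = tm n"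
  by (cases "n = 0") (simp_all add: tm.simps[of "2 * n"])

lemma tm_Suc_double [simp]: "tm (Suc (2 * n)) = (\<not> tm n)"
  by (simp add: tm.simps[of "Suc (2 * n)"])

lemma tm_eq_Suc_imp_odd: "tm n = tm (Suc n) \<Longrightarrow> odd n"
  by (auto elim!: evenE)

lemma tm_no_cube: "tm n = tm (Suc n) \<Longrightarrow> tm (Suc n) \<noteq> tm (Suc (Suc n))"
  using tm_eq_Suc_imp_odd[of n] tm_eq_Suc_imp_odd[of "Suc n"] by auto

text \<open>Five alternating letters would agree at \<open>i\<close>, \<open>i + 2\<close> and
  \<open>i + 4\<close>. These positions have the same parity, so halving them gives three equal
  adjacent letters.\<close>

lemma tm_square_nearby: "\<exists>j < 4. tm (i + j) = tm (Suc (i + j))"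
proof (rule ccontr)
  assume "\<not> ?thesis"
  then have alt: "tm (i + j) \<noteq> tm (Suc (i + j))" if "j < 4" for j
    using that by blast
  define m where "m = i div 2"
  have eqs: "tm i = tm (i + 2)" "tm (i + 2) = tm (i + 4)"
    using alt[of 0] alt[of 1] alt[of 2] alt[of 3] by (auto simp: numeral_eq_Suc)
  have "tm m = tm (Suc m) \<and> tm (Suc m) = tm (Suc (Suc m))"
  proof (cases "even i")
    case True
    then have "i = 2 * m" "i + 2 = 2 * Suc m" "i + 4 = 2 * Suc (Suc m)"
      by (auto simp: m_def)
    then show ?thesis
      using eqs by (metis tm_double)
  next
    case False
    then have "i = Suc (2 * m)" "i + 2 = Suc (2 * Suc m)" "i + 4 = Suc (2 * Suc (Suc m))"
      by (auto simp: m_def)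
    then show ?thesis
      using eqs by (metis tm_Suc_double)
  qed
  then show False
    using tm_no_cube by blast
qed

text \<open>Descent on the period. For even \<open>p\<close>, every second letter would form an
  overlap of period \<open>p div 2\<close>. For odd \<open>p\<close>, two equal adjacent letters and
  their copy shifted by \<open>p\<close> would both begin at odd positions.\<close>

lemma tm_no_overlap: "p > 0 \<Longrightarrow> \<exists>j \<le> p. tm (i + j) \<noteq> tm (i + j + p)"
proof (induction p arbitrary: i rule: less_induct)
  case (less p)
  show ?case
  proof (cases "even p")
    case True
    then obtain q where q: "p = 2 * q" by blast
    then obtain j where j: "j \<le> q" "tm (i div 2 + j) \<noteq> tm (i div 2 + j + q)"
      using less.IH[of q "i div 2"] less.prems by auto
    have "tm (i + 2 * j) \<noteq> tm (i + 2 * j + p)"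
    proof (cases "even i")
      case True
      then have "i + 2 * j = 2 * (i div 2 + j)" "i + 2 * j + p = 2 * (i div 2 + j + q)"
        using q by auto
      then show ?thesis
        using j by (metis tm_double)
    next
      case False
      then have "i + 2 * j = Suc (2 * (i div 2 + j))"
        "i + 2 * j + p = Suc (2 * (i div 2 + j + q))"
        using q by auto
      then show ?thesis
        using j by (metis tm_Suc_double)
    qed
    then show ?thesis
      using j q by (intro exI[of _ "2 * j"]) auto
  next
    case False
    show ?thesis
    proof (rule ccontr)
      assume "\<not> ?thesis"
      then have per: "tm (i + j) = tm (i + j + p)" if "j \<le> p" for j
        using that by blast
      have "\<exists>j. Suc j \<le> p \<and> tm (i + j) = tm (Suc (i + j))"
      proof -
        have "p = 1 \<or> p = 3 \<or> p \<ge> 4"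
          using False less.prems by presburger
        then consider "p = 1" | "p = 3" | "p \<ge> 4"
          by blast
        then show ?thesis
        proof cases
          case 1
          then show ?thesis
            using per[of 0] by auto
        next
          case 2
          then have "tm i = tm (i + 3)"
            using per[of 0] by simp
          \<comment> \<open>Over two letters, three successive changes would make the end letters
            differ.\<close>
          then have "tm i = tm (i + 1) \<or> tm (i + 1) = tm (i + 2) \<or> tm (i + 2) = tm (i + 3)"
            by blast
          then show ?thesis
            using 2 by (metis One_nat_def Suc_1 add.right_neutral add_Suc_right le_add2
                le_numeral_extra(4) numeral_3_eq_3 plus_1_eq_Suc Suc_le_mono zero_le)
        next
          case 3
          then show ?thesis
            using tm_square_nearby[of i] by (meson Suc_leI le_trans)
        qed
      qed
      then obtain j where j: "Suc j \<le> p" "tm (i + j) = tm (Suc (i + j))"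
        by blast
      have "tm (i + j + p) = tm (Suc (i + j + p))"
        using per[of j] per[of "Suc j"] j by simp
      then show False
        using False j tm_eq_Suc_imp_odd[of "i + j"] tm_eq_Suc_imp_odd[of "i + j + p"] by simp
    qed
  qed
qed

lemma tm_factor_overlap_free: "\<not> has_overlap (map tm [a..<b])"
proof
  assume "has_overlap (map tm [a..<b])"
  then obtain u where u: "sublist u (map tm [a..<b])" "overlap u"
    by (auto simp flip: overlap_sublist_iff_has_overlap)
  then obtain x Y ps ss where w: "map tm [a..<b] = ps @ ([x] @ Y @ [x] @ Y @ [x]) @ ss"
    by (auto simp: overlap_def sublist_def)
  define p where "p = Suc (length Y)"
  define V where "V = [x] @ Y @ [x] @ Y @ [x]"
  have V: "V ! j = V ! (j + p)" if "j \<le> p" for j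
    using that by (auto simp: V_def p_def nth_append nth_Cons split: nat.splits)
  have len: "length ps + length V \<le> b - a"
    using arg_cong[OF w, of length] by (simp add: V_def)
  have tm_V: "tm (a + length ps + j) = V ! j" if "j < length V" for j
  proof -
    have "map tm [a..<b] ! (length ps + j) = V ! j"
      using that unfolding w V_def[symmetric] by (simp add: nth_append)
    then show ?thesis
      using that len by (simp add: add.assoc)
  qed
  have "tm (a + length ps + j) = tm (a + length ps + j + p)" if "j \<le> p" for j
    using tm_V[of j] tm_V[of "j + p"] V[OF that] that
    by (simp add: V_def p_def add.assoc)
  then show False
    using tm_no_overlap[of p "a + length ps"] by (auto simp: p_def)
qed

section \<open>Self-similarity of the Thue--Morse word\<close>

definition tm_morphism :: "bool list \<Rightarrow> bool list" where
  "tm_morphism w = concat (map (\<lambda>b. [b, \<not> b]) w)"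

lemma tm_morphism_factor: "map tm [2 * a..<2 * b] = tm_morphism (map tm [a..<b])"
proof (induction b)
  case (Suc b)
  show ?case
  proof (cases "a \<le> b")
    case True
    then have "[2 * a..<2 * Suc b] = [2 * a..<2 * b] @ [2 * b, Suc (2 * b)]"
      by simp
    then have "map tm [2 * a..<2 * Suc b] = map tm [2 * a..<2 * b] @ [tm b, \<not> tm b]"
      by (simp only: map_append list.map tm_double tm_Suc_double)
    with Suc True show ?thesis
      by (simp add: tm_morphism_def)
  qed (simp add: tm_morphism_def)
qed (simp add: tm_morphism_def)

text \<open>Reduces statements about all positions in a residue class modulo \<open>2 ^ k\<close> to
  finitely many checks on images of short words.\<close>

lemma tm_morphism_factor_power:
  "map tm [2 ^ k * a..<2 ^ k * b] = (tm_morphism ^^ k) (map tm [a..<b])"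
proof (induction k)
  case (Suc k)
  then show ?case
    using tm_morphism_factor[of "2 ^ k * a" "2 ^ k * b"] by (simp add: mult.assoc)
qed simp

section \<open>Critical positions\<close>

text \<open>Bounds and deleted position are absolute positions in the infinite word, so a window can
  be enlarged without reindexing.\<close>

definition critical :: "nat \<Rightarrow> nat \<Rightarrow> nat \<Rightarrow> bool" where
  "critical a b x \<longleftrightarrow> has_overlap (map tm [a..<x] @ map tm [Suc x..<b])"

lemma critical_mono:
  assumes "critical c d x" "a \<le> c" "c \<le> x" "x < d" "d \<le> b"
  shows "critical a b x"
proof -
  have "[a..<x] = [a..<c] @ [c..<x]" "[Suc x..<b] = [Suc x..<d] @ [d..<b]"
    using assms upt_add_eq_append[of a c "x - c"] upt_add_eq_append[of "Suc x" d "b - d"] by auto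
  then have "map tm [a..<x] @ map tm [Suc x..<b] =
      map tm [a..<c] @ (map tm [c..<x] @ map tm [Suc x..<d]) @ map tm [d..<b]"
    by simp
  then have "sublist (map tm [c..<x] @ map tm [Suc x..<d]) (map tm [a..<x] @ map tm [Suc x..<b])"
    unfolding sublist_def by metis
  then show ?thesis
    using assms(1) unfolding critical_def by (rule has_overlap_mono[rotated])
qed

lemma tm_factor_irreducible:
  assumes "3 \<le> n" "\<And>x. a < x \<Longrightarrow> Suc x < a + n \<Longrightarrow> critical a (a + n) x"
  shows "irreducible_overlap_free (map tm [a..<a + n])"
proof -
  have "has_overlap (take i (map tm [a..<a + n]) @ drop (Suc i) (map tm [a..<a + n]))"
    if "1 \<le> i" "i < n - 1" for i
    using assms(2)[of "a + i"] that
    by (simp add: critical_def take_map drop_map take_upt drop_upt)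
  then show ?thesis
    using assms(1) by (simp add: irreducible_overlap_free_iff tm_factor_overlap_free)
qed

text \<open>Executable counterpart of \<open>critical\<close>, with positions counted from the start
  of the finite word \<open>w\<close>.\<close>

definition window_test :: "bool list \<Rightarrow> nat \<Rightarrow> nat \<Rightarrow> nat \<Rightarrow> bool" where
  "window_test w i j r \<longleftrightarrow> has_overlap (take (r - i) (drop i w) @ take (j - Suc r) (drop (Suc r) w))"

lemma critical_by_window_test:
  assumes "window_test ((tm_morphism ^^ k) (map tm [q..<q + m])) i j r"
    and "i \<le> r" "r < j" "j \<le> 2 ^ k * m"
  shows "critical (2 ^ k * q + i) (2 ^ k * q + j) (2 ^ k * q + r)"
proof -
  define A where "A = 2 ^ k * q"
  have "(tm_morphism ^^ k) (map tm [q..<q + m]) = map tm [A..<A + 2 ^ k * m]"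
    using tm_morphism_factor_power[of k q "q + m"] by (simp add: A_def distrib_left)
  then show ?thesis
    using assms unfolding critical_def window_test_def A_def[symmetric]
    by (simp add: take_map drop_map take_upt drop_upt)
qed

text \<open>A window of length 9 starting at offset \<open>r < 4\<close> in a block of length 4 fits
  into three blocks, the images of letters \<open>b\<close>, \<open>c\<close>, \<open>d\<close>.
  Three consecutive Thue--Morse letters are never all equal, whence the premise.\<close>

lemma interior_window_tests:
  "\<forall>b c d. b \<noteq> c \<or> c \<noteq> d \<longrightarrow>
     list_all (\<lambda>r. window_test ((tm_morphism ^^ 2) [b, c, d]) r (r + 9) (r + 4)) [0..<4]"
  by code_simp

lemma critical_interior:
  assumes "4 \<le> x"
  shows "critical (x - 4) (x + 5) x"
proof -
  define q r where "q = (x - 4) div 4" and "r = (x - 4) mod 4"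
  have x: "x = 4 * q + (r + 4)" and r: "r < 4"
    using assms by (auto simp: q_def r_def)
  have "map tm [q..<q + 3] = [tm q, tm (Suc q), tm (Suc (Suc q))]"
    by (simp add: numeral_eq_Suc)
  moreover have "tm q \<noteq> tm (Suc q) \<or> tm (Suc q) \<noteq> tm (Suc (Suc q))"
    using tm_no_cube by blast
  moreover have "r \<in> set [0..<4]"
    using r by simp
  ultimately have "window_test ((tm_morphism ^^ 2) (map tm [q..<q + 3])) r (r + 9) (r + 4)"
    using interior_window_tests unfolding list_all_iff by metis
  from critical_by_window_test[OF this] r show ?thesis
    by (simp add: x ac_simps)
qed

text \<open>Letters with at least four neighbours on each side are settled by
  \<open>critical_interior\<close>; the remaining ones are the first three and the last three
  interior letters.\<close>

lemma tm_factor_irreducible_by_ends: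
  assumes "3 \<le> n"
    and "\<And>x. a < x \<Longrightarrow> x < a + 4 \<Longrightarrow> Suc x < a + n \<Longrightarrow> critical a (a + n) x"
    and "\<And>x. a < x \<Longrightarrow> a + n < x + 5 \<Longrightarrow> Suc x < a + n \<Longrightarrow> critical a (a + n) x"
  shows "irreducible_overlap_free (map tm [a..<a + n])"
proof (rule tm_factor_irreducible[OF assms(1)])
  fix x assume x: "a < x" "Suc x < a + n"
  show "critical a (a + n) x"
  proof (cases "a + 4 \<le> x \<and> x + 5 \<le> a + n")
    case True
    then show ?thesis
      by (intro critical_mono[OF critical_interior[of x]]) auto
  next
    case False
    with x assms(2,3)[of x] show ?thesis
      by auto
  qed
qed

section \<open>Short factors\<close>

text \<open>Pairs of a length and a starting position in the Thue--Morse word, found by search.\<close>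

definition short_factors :: "(nat \<times> nat) list" where
  "short_factors =
    [(6, 11), (8, 0), (9, 8), (10, 11), (12, 2), (13, 8), (14, 0), (15, 2), (16, 0), (17, 0),
     (18, 2), (19, 2), (20, 0), (21, 0), (22, 2), (23, 15), (24, 0), (25, 11), (26, 0), (27, 11),
     (28, 2), (29, 8), (30, 0), (31, 6), (32, 0), (33, 11)]"

text \<open>The sixfold image of \<open>[False]\<close> is the prefix of length 64, which contains
  every listed factor. The filter keeps the interior letters near the ends.\<close>

lemma short_factors_tests:
  "list_all (\<lambda>(n, a). list_all (\<lambda>r. window_test ((tm_morphism ^^ 6) [False]) a (a + n) (a + r))
     (filter (\<lambda>r. r < 4 \<or> n < r + 5) [1..<n - 1])) short_factors"
  by code_simp

lemma tm_singleton_0: "map tm [0..<0 + 1] = [False]"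
  by (simp add: tm.simps[of 0])

lemma short_factor_irreducible:
  assumes "(n, a) \<in> set short_factors"
  shows "irreducible_overlap_free (map tm [a..<a + n])"
proof -
  have n: "3 \<le> n" "a + n \<le> 64"
    using assms by (auto simp: short_factors_def)
  have "critical a (a + n) x"
    if x: "a < x" "Suc x < a + n" "x < a + 4 \<or> a + n < x + 5" for x
  proof -
    define r where "r = x - a"
    have r: "x = a + r" "r \<in> set (filter (\<lambda>r. r < 4 \<or> n < r + 5) [1..<n - 1])"
      using x by (auto simp: r_def)
    then have "window_test ((tm_morphism ^^ 6) (map tm [0..<0 + 1])) a (a + n) x"
      using short_factors_tests assms unfolding tm_singleton_0 list_all_iff by fast
    from critical_by_window_test[OF this] x n show ?thesis
      by simp
  qed
  then show ?thesis
    using n by (intro tm_factor_irreducible_by_ends) auto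
qed

section \<open>Long factors\<close>

text \<open>The starts represent all even classes modulo 16, with 20 and 26 standing for 4 and 10.
  Windows of length 34 suffice for all longer factors by \<open>critical_mono\<close>.\<close>

lemma start_tests:
  "list_all (\<lambda>a. list_all (\<lambda>r. window_test ((tm_morphism ^^ 6) [False]) a (a + 34) (a + r)) [1, 2, 3])
     [0, 2, 6, 8, 12, 14, 20, 26]"
  by code_simp

lemma critical_start:
  assumes "a \<in> set [0, 2, 6, 8, 12, 14, 20, 26]" "a < x" "x < a + 4" "34 \<le> n"
  shows "critical a (a + n) x"
proof -
  obtain r where r: "x = a + r" "r \<in> set [1, 2, 3]"
    using assms less_imp_add_positive[of a x] by fastforce
  then have "window_test ((tm_morphism ^^ 6) (map tm [0..<0 + 1])) a (a + 34) x"
    using start_tests assms(1) unfolding tm_singleton_0 list_all_iff by blast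
  then have "critical (2 ^ 6 * 0 + a) (2 ^ 6 * 0 + (a + 34)) (2 ^ 6 * 0 + x)"
    by (rule critical_by_window_test) (use assms in auto)
  then show ?thesis
    using assms by (auto intro: critical_mono[of a "a + 34"])
qed

lemma end_tests_8:
  "\<forall>b. list_all (\<lambda>r. window_test ((tm_morphism ^^ 3) [b]) 2 8 r) [4, 5, 6]"
  by code_simp

text \<open>The end 21 is 5 modulo 16, so the window reaches into a second block of length 16. The
  deleted positions 17, 18, 19 are its last three interior letters.\<close>

lemma end_tests_16:
  "\<forall>b c. list_all (\<lambda>r. window_test ((tm_morphism ^^ 4) [b, c]) 7 21 r) [17, 18, 19]"
  by code_simp

lemma critical_end_8:
  assumes "e = 8 * q + 8" "e < x + 5" "Suc x < e" "a + 6 \<le> e"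
  shows "critical a e x"
proof -
  obtain r where r: "x = 8 * q + r" "r \<in> set [4, 5, 6]"
    using assms le_Suc_ex[of "8 * q" x] by fastforce
  have "map tm [q..<q + 1] = [tm q]"
    by simp
  then have "window_test ((tm_morphism ^^ 3) (map tm [q..<q + 1])) 2 8 r"
    using end_tests_8 r(2) unfolding list_all_iff by metis
  then have "critical (2 ^ 3 * q + 2) (2 ^ 3 * q + 8) (2 ^ 3 * q + r)"
    by (rule critical_by_window_test) (use r in auto)
  then show ?thesis
    using r assms by (auto intro: critical_mono[of "8 * q + 2" "8 * q + 8"])
qed

lemma critical_end_16:
  assumes "e = 16 * q + 21" "e < x + 5" "Suc x < e" "a + 14 \<le> e"
  shows "critical a e x"
proof -
  obtain r where r: "x = 16 * q + r" "r \<in> set [17, 18, 19]"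
    using assms le_Suc_ex[of "16 * q" x] by fastforce
  have "map tm [q..<q + 2] = [tm q, tm (Suc q)]"
    by (simp add: numeral_eq_Suc)
  then have "window_test ((tm_morphism ^^ 4) (map tm [q..<q + 2])) 7 21 r"
    using end_tests_16 r(2) unfolding list_all_iff by metis
  then have "critical (2 ^ 4 * q + 7) (2 ^ 4 * q + 21) (2 ^ 4 * q + r)"
    by (rule critical_by_window_test) (use r in auto)
  then show ?thesis
    using r assms by (auto intro: critical_mono[of "16 * q + 7" "16 * q + 21"])
qed

lemma long_factor_irreducible:
  assumes "34 \<le> n" "a \<in> set [0, 2, 6, 8, 12, 14, 20, 26]"
    and "(a + n) mod 16 \<in> {0, 5, 8}"
  shows "irreducible_overlap_free (map tm [a..<a + n])"
proof (rule tm_factor_irreducible_by_ends)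
  fix x assume x: "a < x" "a + n < x + 5" "Suc x < a + n"
  define q where "q = (a + n) div 16"
  have e: "a + n = 16 * q + (a + n) mod 16"
    by (simp add: q_def)
  consider "(a + n) mod 16 = 0" | "(a + n) mod 16 = 5" | "(a + n) mod 16 = 8"
    using assms(3) unfolding insert_iff empty_iff by argo
  then show "critical a (a + n) x"
  proof cases
    case 1
    \<comment> \<open>Since \<open>n\<close> is at least 34, \<open>q\<close> is positive and the
      truncated subtraction is exact; the same holds for \<open>q - 1\<close> in the next
      case.\<close>
    with e assms(1) have "a + n = 8 * (2 * q - 1) + 8"
      by linarith
    then show ?thesis
      using x assms(1) by (intro critical_end_8) auto
  next
    case 2
    with e assms(1) have "a + n = 16 * (q - 1) + 21"
      by linarith
    then show ?thesis
      using x assms(1) by (intro critical_end_16) auto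
  next
    case 3
    with e have "a + n = 8 * (2 * q) + 8"
      by linarith
    then show ?thesis
      using x assms(1) by (intro critical_end_8) auto
  qed
qed (use assms critical_start in auto)

text \<open>As the starts meet every even class modulo 16, an even \<open>n\<close> can reach an
  even end class and an odd \<open>n\<close> the end class 5.\<close>

lemma exists_long_factor:
  "\<exists>a \<in> set [0, 2, 6, 8, 12, 14, 20, 26 :: nat]. (a + n) mod 16 \<in> {0, 5, 8}"
proof -
  have "\<forall>k \<in> set [0..<16]. \<exists>a \<in> set [0, 2, 6, 8, 12, 14, 20, 26 :: nat]. (a + k) mod 16 \<in> {0, 5, 8}"
    by code_simp
  moreover have "n mod 16 \<in> set [0..<16]"
    by simp
  ultimately have "\<exists>a \<in> set [0, 2, 6, 8, 12, 14, 20, 26]. (a + n mod 16) mod 16 \<in> {0, 5, 8}"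
    by blast
  then show ?thesis
    unfolding mod_add_right_eq .
qed

section \<open>The set of attained lengths\<close>

theorem theorem1:
  fixes n :: nat
  shows "(\<exists>w :: bool list. length w = n \<and> irreducible_overlap_free w)
    \<longleftrightarrow> n \<in> {6, 8, 9, 10} \<union> {m. m \<ge> 12}"
proof
  assume "\<exists>w :: bool list. length w = n \<and> irreducible_overlap_free w"
  then show "n \<in> {6, 8, 9, 10} \<union> {m. m \<ge> 12}"
    using irreducible_length by blast
next
  assume n: "n \<in> {6, 8, 9, 10} \<union> {m. m \<ge> 12}"
  have "\<exists>a. irreducible_overlap_free (map tm [a..<a + n])"
  proof (cases "34 \<le> n")
    case True
    then show ?thesis
      using exists_long_factor[of n] long_factor_irreducible[OF True] by metis
  next
    case False
    \<comment> \<open>Below 34 the claimed set is exactly the interval from 6 to 33 without 7 and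
      11.\<close>
    have "set [6..<34] - {7, 11} \<subseteq> fst ` set short_factors"
      by code_simp
    moreover have "n \<in> set [6..<34] - {7, 11}"
      using n False unfolding set_upt atLeastLessThan_iff Diff_iff by auto
    ultimately have "n \<in> fst ` set short_factors"
      by blast
    then show ?thesis
      using short_factor_irreducible by force
  qed
  then show "\<exists>w :: bool list. length w = n \<and> irreducible_overlap_free w"
    by (metis add_diff_cancel_left' length_map length_upt)
qed

end
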